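(* Let $T$ be a tree, let $u,v\in V(T)$ be distinct nonadjacent vertices, and let $H=T+uv$ be the graph obtained by adding the edge $uv$. Then $$I(H;x)=I(T;x)-x^2\,I\bigl(T-N[u]-N[v];x\bigr).$$
   Context: Graphs are finite and simple. $I(G;x)=\sum_{j\ge 0}s_j(G)x^j$ is the independence polynomial, where $s_j(G)$ is the number of independent sets of size $j$ in $G$ (so $I$ of the empty graph is $1$). $N[w]$ denotes the closed neighborhood of $w$ in $T$, and $T-N[u]-N[v]$ is the subgraph of $T$ induced by $V(T)\setminus(N[u]\cup N[v])$. *)

theory Defs
  imports
    "HOL-Computational_Algebra.Polynomial"
    "Graph_Theory.Digraph_Component"
begin

text \<open>
  Finite simple graphs are the \<^locale>\<open>pair_graph\<close>s of Graph_Theory: an undirected edge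
  between \<open>u\<close> and \<open>v\<close> is the pair of opposite arcs \<open>(u, v)\<close> and \<open>(v, u)\<close>.
\<close>

text \<open>
  The library's \<^const>\<open>tree\<close> is unsuitable for graphs in this encoding: its cycles are directed, so
  \<open>u, v, u\<close> counts as a cycle whenever \<open>u\<close> and \<open>v\<close> are adjacent. In a simple undirected graph a
  cycle has at least three edges, hence the length condition. \<open>Digraph_Component.connected\<close>
  requires at least one vertex.
\<close>

definition undirected_tree :: "'a pair_pre_digraph \<Rightarrow> bool" where
  "undirected_tree T \<longleftrightarrow> pair_graph T \<and> Digraph_Component.connected (with_proj T) \<and>
     \<not> (\<exists>p. pre_digraph.cycle (with_proj T) p \<and> 3 \<le> length p)"

definition add_edge :: "'a pair_pre_digraph \<Rightarrow> 'a \<Rightarrow> 'a \<Rightarrow> 'a pair_pre_digraph" where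
  "add_edge G u v = \<lparr> pverts = pverts G, parcs = parcs G \<union> {(u, v), (v, u)} \<rparr>"

definition closed_nbhd :: "('a, 'b) pre_digraph \<Rightarrow> 'a \<Rightarrow> 'a set" where
  "closed_nbhd G w = insert w {y \<in> verts G. w \<rightarrow>\<^bsub>G\<^esub> y}"

definition independent_set :: "('a, 'b) pre_digraph \<Rightarrow> 'a set \<Rightarrow> bool" where
  "independent_set G S \<longleftrightarrow> S \<subseteq> verts G \<and> (\<forall>x\<in>S. \<forall>y\<in>S. \<not> x \<rightarrow>\<^bsub>G\<^esub> y)"

definition num_indep :: "('a, 'b) pre_digraph \<Rightarrow> nat \<Rightarrow> nat" where
  "num_indep G j = card {S. independent_set G S \<and> card S = j}"

text \<open>
  The sum stops at the number of vertices, beyond which all coefficients \<open>s\<^sub>j(G)\<close> vanish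
  (for finite \<open>G\<close>; see \<open>coeff_indep_poly\<close> below).
\<close>

definition indep_poly :: "('a, 'b) pre_digraph \<Rightarrow> int poly" where
  "indep_poly G = (\<Sum>j\<le>card (verts G). monom (int (num_indep G j)) j)"

lemma coeff_indep_poly:
  assumes "finite (verts G)"
  shows "coeff (indep_poly G) j = int (num_indep G j)"
proof (cases "j \<le> card (verts G)")
  case True
  then show ?thesis
    by (simp add: indep_poly_def coeff_sum)
next
  case False
  then have "{S. independent_set G S \<and> card S = j} = {}"
    using assms by (auto simp: independent_set_def dest: card_mono)
  then have "num_indep G j = 0"
    unfolding num_indep_def by (simp only: card.empty)
  with False show ?thesis
    by (simp add: indep_poly_def coeff_sum)
qed

lemma indep_poly_empty:
  assumes "verts G = {}"
  shows "indep_poly G = 1"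
proof -
  have "{S. independent_set G S \<and> card S = 0} = {{}}"
    using assms by (auto simp: independent_set_def)
  then show ?thesis
    using assms by (simp add: indep_poly_def num_indep_def)
qed

lemma pair_graph_add_edge:
  assumes "pair_graph G" "u \<in> pverts G" "v \<in> pverts G" "u \<noteq> v"
  shows "pair_graph (add_edge G u v)"
proof -
  interpret pair_graph G by fact
  show ?thesis
    using assms(2-4) pair_finite_verts pair_finite_arcs pair_no_loops arcs_symmetric
    by unfold_locales (auto simp: add_edge_def symmetric_def intro!: symI dest: in_arcsD1 in_arcsD2)
qed

end

theory Submission
  imports Defs
begin

text \<open>
  An independent set of \<open>T\<close> stays independent in \<open>T + uv\<close> unless it contains both \<open>u\<close> and \<open>v\<close>.
  Deleting \<open>u\<close> and \<open>v\<close> turns the sets that are lost into the independent sets avoiding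
  \<open>N[u] \<union> N[v]\<close>, and lowers the size by two.
\<close>

text \<open>Grouping the independent sets by size shows that each contributes one monomial. Summing
  over sets instead of sizes lets the main identity be proved by splitting and reindexing index
  sets, without comparing coefficients.\<close>

lemma indep_poly_conv_sum:
  assumes "finite (verts G)"
  shows "indep_poly G = (\<Sum>S | independent_set G S. monom 1 (card S))"
proof (rule poly_eqI)
  fix j
  have "finite {S. independent_set G S}"
    by (rule finite_subset[of _ "Pow (verts G)"]) (auto simp: independent_set_def assms)
  then have "coeff (\<Sum>S | independent_set G S. monom (1::int) (card S)) j
      = int (card {S \<in> {S. independent_set G S}. card S = j})"
    by (simp add: coeff_sum sum.If_cases Int_def)
  then show "coeff (indep_poly G) j = coeff (\<Sum>S | independent_set G S. monom 1 (card S)) j"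
    by (simp add: coeff_indep_poly[OF assms] num_indep_def)
qed

lemma independent_set_induce_subgraph:
  assumes "W \<subseteq> verts G"
  shows "independent_set (G \<restriction> W) S \<longleftrightarrow> S \<subseteq> W \<and> independent_set G S"
proof -
  have "x \<rightarrow>\<^bsub>G \<restriction> W\<^esub> y \<longleftrightarrow> x \<rightarrow>\<^bsub>G\<^esub> y" if "x \<in> W" "y \<in> W" for x y
    using that by (auto simp: arcs_ends_def arc_to_ends_def induce_subgraph_def)
  then show ?thesis
    using assms by (simp add: independent_set_def) blast
qed

lemma independent_set_add_edge:
  assumes "u \<noteq> v"
  shows "independent_set (with_proj (add_edge G u v)) S \<longleftrightarrow>
    independent_set (with_proj G) S \<and> \<not> (u \<in> S \<and> v \<in> S)"
  using assms by (simp add: independent_set_def add_edge_def) blast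

text \<open>Adding \<open>w\<close> can only create conflicts along arcs at \<open>w\<close>: loops
  do not exist, and symmetry reduces arcs into \<open>w\<close> to arcs out of \<open>w\<close>.
  Since \<open>w\<close> is not in \<open>S\<close>, the center of the closed neighborhood adds no
  condition.\<close>

lemma (in pair_graph) independent_set_insert_iff:
  assumes "w \<in> pverts G" "w \<notin> S"
  shows "independent_set (with_proj G) (insert w S) \<longleftrightarrow>
    independent_set (with_proj G) S \<and> S \<inter> closed_nbhd (with_proj G) w = {}"
proof -
  have "(w, w) \<notin> parcs G"
    using pair_no_loops by force
  moreover have "(\<forall>x\<in>S. (x, w) \<notin> parcs G) \<longleftrightarrow> (\<forall>x\<in>S. (w, x) \<notin> parcs G)"
    using arcs_symmetric by blast
  moreover have "S \<inter> closed_nbhd (with_proj G) w = {} \<longleftrightarrow> (\<forall>x\<in>S. (w, x) \<notin> parcs G)"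
    using assms(2) by (auto simp: closed_nbhd_def dest: in_arcsD2)
  ultimately show ?thesis
    using assms(1) by (simp add: independent_set_def ball_conj_distrib) argo
qed

lemma (in pair_graph) indep_poly_add_edge:
  assumes u: "u \<in> pverts G" and v: "v \<in> pverts G" and "u \<noteq> v"
    and nadj: "\<not> u \<rightarrow>\<^bsub>with_proj G\<^esub> v"
  shows "indep_poly (with_proj (add_edge G u v)) =
    indep_poly (with_proj G) -
    [:0, 1:]\<^sup>2 * indep_poly (with_proj G \<restriction>
      (pverts G - (closed_nbhd (with_proj G) u \<union> closed_nbhd (with_proj G) v)))"
proof -
  define W where "W = pverts G - (closed_nbhd (with_proj G) u \<union> closed_nbhd (with_proj G) v)"
  let ?I = "{S. independent_set (with_proj G) S}"
  let ?J = "{S. independent_set (with_proj (add_edge G u v)) S}"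
  let ?K = "{S. independent_set (with_proj G \<restriction> W) S}"
  have "W \<subseteq> verts (with_proj G)" "u \<notin> W" "v \<notin> W"
    by (auto simp: W_def closed_nbhd_def)
  have finW: "finite W"
    by (simp add: W_def)
  have finI: "finite ?I"
    by (rule finite_subset[of _ "Pow (pverts G)"]) (auto simp: independent_set_def)
  have K: "S \<in> ?K \<longleftrightarrow> S \<subseteq> W \<and> S \<in> ?I" for S
    using independent_set_induce_subgraph[OF \<open>W \<subseteq> verts (with_proj G)\<close>] by simp
  have ins: "insert u (insert v S) \<in> ?I \<longleftrightarrow> S \<in> ?K" if "u \<notin> S" "v \<notin> S" for S
  proof -
    have "u \<notin> closed_nbhd (with_proj G) v"
      using nadj \<open>u \<noteq> v\<close> arcs_symmetric[of v u] by (auto simp: closed_nbhd_def)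
    moreover have "v \<notin> closed_nbhd (with_proj G) u"
      using nadj \<open>u \<noteq> v\<close> by (auto simp: closed_nbhd_def)
    \<comment> \<open>First \<open>v\<close> is added to \<open>S\<close>, then \<open>u\<close> to
      \<open>insert v S\<close>. The second step asks that \<open>insert v S\<close> avoid N[u]; as
      \<open>v\<close> lies outside N[u], this is a condition on \<open>S\<close> alone.\<close>
    ultimately have "insert u (insert v S) \<in> ?I \<longleftrightarrow> S \<in> ?I \<and>
        S \<inter> closed_nbhd (with_proj G) u = {} \<and> S \<inter> closed_nbhd (with_proj G) v = {}"
      using that \<open>u \<noteq> v\<close> independent_set_insert_iff[OF u, of "insert v S"]
        independent_set_insert_iff[OF v, of S]
      by simp blast
    \<comment> \<open>Independence puts \<open>S\<close> inside the vertex set, so only the two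
      avoidance conditions remain.\<close>
    moreover have "S \<subseteq> W \<longleftrightarrow>
        S \<inter> closed_nbhd (with_proj G) u = {} \<and> S \<inter> closed_nbhd (with_proj G) v = {}"
      if "S \<in> ?I"
      using that by (simp add: independent_set_def W_def) blast
    ultimately show ?thesis
      unfolding K by argo
  qed
  have "?J = ?I - {S \<in> ?I. u \<in> S \<and> v \<in> S}"
    using independent_set_add_edge[OF \<open>u \<noteq> v\<close>] by auto
  then have "indep_poly (with_proj (add_edge G u v)) =
      (\<Sum>S \<in> ?I - {S \<in> ?I. u \<in> S \<and> v \<in> S}. monom 1 (card S))"
    by (subst indep_poly_conv_sum) (simp_all add: add_edge_def)
  also have "\<dots> = indep_poly (with_proj G) - (\<Sum>S | S \<in> ?I \<and> u \<in> S \<and> v \<in> S. monom 1 (card S))"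
    using finI by (subst sum_diff) (auto simp: indep_poly_conv_sum)
  also have "(\<Sum>S | S \<in> ?I \<and> u \<in> S \<and> v \<in> S. monom 1 (card S)) =
      (\<Sum>S\<in>?K. [:0, 1:]\<^sup>2 * monom (1::int) (card S))"
  proof (rule sum.reindex_bij_witness[of _ "\<lambda>S. insert u (insert v S)" "\<lambda>S. S - {u, v}"])
    fix S assume S: "S \<in> {S. S \<in> ?I \<and> u \<in> S \<and> v \<in> S}"
    then show *: "insert u (insert v (S - {u, v})) = S"
      by auto
    show "S - {u, v} \<in> ?K"
      using ins[of "S - {u, v}"] S unfolding * by simp
    \<comment> \<open>Without finiteness \<open>card\<close> would default to 0 and the drop by two
      would fail.\<close>
    have "finite S"
      using S by (auto simp: independent_set_def intro: finite_subset)
    then have "card S = Suc (Suc (card (S - {u, v})))"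
      using \<open>u \<noteq> v\<close> by (subst *[symmetric], subst card_insert_disjoint) auto
    \<comment> \<open>The polynomial \<open>[:0, 1:]\<close> is x, so its square restores the two
      removed vertices in the exponent.\<close>
    then show "[:0, 1:]\<^sup>2 * monom 1 (card (S - {u, v})) = monom (1::int) (card S)"
      by (simp add: power2_eq_square monom_Suc)
  next
    fix S assume S: "S \<in> ?K"
    \<comment> \<open>Closed neighborhoods contain their centers, so \<open>W\<close> omits
      \<open>u\<close> and \<open>v\<close>; hence deleting them after insertion gives back
      \<open>S\<close>.\<close>
    then have "u \<notin> S" "v \<notin> S"
      using K \<open>u \<notin> W\<close> \<open>v \<notin> W\<close> by blast+
    with ins[of S] S show "insert u (insert v S) \<in> {S. S \<in> ?I \<and> u \<in> S \<and> v \<in> S}"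
      "insert u (insert v S) - {u, v} = S"
      by auto
  qed
  also have "\<dots> = [:0, 1:]\<^sup>2 * indep_poly (with_proj G \<restriction> W)"
    using finW by (simp add: indep_poly_conv_sum sum_distrib_left)
  finally show ?thesis
    unfolding W_def .
qed

theorem proposition2p2:
  fixes T H :: "'a pair_pre_digraph" and u v :: 'a
  assumes "undirected_tree T"
    and "u \<in> pverts T" and "v \<in> pverts T"
    and "u \<noteq> v"
    and "\<not> u \<rightarrow>\<^bsub>with_proj T\<^esub> v"
    and "H = add_edge T u v"
  shows "indep_poly (with_proj H) =
    indep_poly (with_proj T) -
    [:0, 1:]\<^sup>2 * indep_poly (with_proj T \<restriction>
      (pverts T - (closed_nbhd (with_proj T) u \<union> closed_nbhd (with_proj T) v)))"
  using assms pair_graph.indep_poly_add_edge[of T u v] by (simp add: undirected_tree_def)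

end
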